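(* Let $\alpha,\lambda\in\mathbb{R}$ and let $\gamma$ be a curve in the simply isotropic plane $\mathbb{I}^2$ parametrized by $\gamma(t)=(t,z(t))$. The following statements are equivalent: 1. The curve $\gamma$ is a critical point of the functional $\mathcal{F}_x^\alpha[\gamma]=\int_\gamma (z^\alpha-\lambda)\,\mathrm{d}s^*$. 2. The function $z$ satisfies $$(z^{\alpha}-\lambda)\ddot z=\alpha z^{\alpha-1}\left(\frac12-\frac{\dot z^2}{2}\right).$$ 3. The simply isotropic curvature $\kappa$ of $\gamma$ satisfies $$\kappa=\alpha\,\langle\langle\gamma,Z\rangle\rangle^{\alpha-1}\,\frac{\langle\langle\mathbf{N}_{par},Z\rangle\rangle}{\langle\langle\gamma,Z\rangle\rangle^{\alpha}-\lambda},$$ where $Z=\partial_z$.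
   Context: The simply isotropic plane $\mathbb{I}^2$ is $\mathbb{R}^2$ with coordinates $(x,z)$ and the degenerate metric $\langle \mathbf u,\mathbf v\rangle=u^1v^1$; the secondary metric is $\langle\langle\mathbf u,\mathbf v\rangle\rangle=u^3v^3$, where $\mathbf u=(u^1,u^3)$, $\mathbf v=(v^1,v^3)$. $Z=\partial_z=(0,1)$. The functional measures weight with respect to the $x$-axis, the distance to it being computed with the secondary metric; curves are smooth and contained in the half-plane $z>0$, so this distance is $z$. For a curve $\gamma(t)=(x(t),z(t))$ with $\dot x>0$: the simply isotropic curvature is $\kappa=\frac{\dot x\ddot z-\ddot x\dot z}{\dot x^3}$; the parabolic normal is $\mathbf{N}_{par}=\left(-\frac{\dot z}{\dot x},\frac12-\frac{\dot z^2}{2\dot x^2}\right)$; the relative arc length element is $\mathrm{d}s^*=\left(\frac{\dot x}{2}+\frac{\dot z^2}{2\dot x}\right)\mathrm{d}t$. The constant $\lambda$ is a Lagrange multiplier due to the length constraint, and critical points are the solutions of the Euler-Lagrange equation of the functional among curves with the same endpoints. *)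

theory Defs
  imports "HOL-Analysis.Analysis"
begin

text \<open>
  Points and vectors of the simply isotropic plane are pairs \<open>(x, z)\<close>; the second component is
  the isotropic direction. A curve is a map on a compact interval \<open>{a..b}\<close> with \<open>a < b\<close>; all its
  derivatives are taken within the interval, so they are one-sided at the endpoints.
\<close>

definition deriv_in :: "real set \<Rightarrow> (real \<Rightarrow> 'a::real_normed_vector) \<Rightarrow> real \<Rightarrow> 'a" where
  "deriv_in S f t = vector_derivative f (at t within S)"

definition smooth_in :: "real set \<Rightarrow> (real \<Rightarrow> 'a::real_normed_vector) \<Rightarrow> bool" where
  "smooth_in S f \<longleftrightarrow> (\<forall>k. (deriv_in S ^^ k) f differentiable_on S)"

definition secondary_metric :: "real \<times> real \<Rightarrow> real \<times> real \<Rightarrow> real" where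
  "secondary_metric u v = snd u * snd v"

definition Z_dir :: "real \<times> real" where
  "Z_dir = (0, 1)"

definition isotropic_curvature :: "real set \<Rightarrow> (real \<Rightarrow> real \<times> real) \<Rightarrow> real \<Rightarrow> real" where
  "isotropic_curvature S \<gamma> t =
     (let v = deriv_in S \<gamma> t; w = deriv_in S (deriv_in S \<gamma>) t
      in (fst v * snd w - fst w * snd v) / fst v ^ 3)"

definition parabolic_normal :: "real set \<Rightarrow> (real \<Rightarrow> real \<times> real) \<Rightarrow> real \<Rightarrow> real \<times> real" where
  "parabolic_normal S \<gamma> t =
     (let v = deriv_in S \<gamma> t
      in (- (snd v / fst v), 1 / 2 - (snd v)\<^sup>2 / (2 * (fst v)\<^sup>2)))"

text \<open>The density of the relative arc length at a velocity \<open>v\<close> with \<open>fst v > 0\<close>.\<close>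

definition rel_arc_density :: "real \<times> real \<Rightarrow> real" where
  "rel_arc_density v = fst v / 2 + (snd v)\<^sup>2 / (2 * fst v)"

text \<open>
  \<open>\<mu>\<close> is the Lagrange multiplier of the length constraint, and \<open>snd q\<close> is the distance of the point \<open>q\<close>
  to the \<open>x\<close>-axis in the secondary metric (for \<open>snd q > 0\<close>).
\<close>

definition weight_lagrangian ::
    "real \<Rightarrow> real \<Rightarrow> real \<times> real \<Rightarrow> real \<times> real \<Rightarrow> real" where
  "weight_lagrangian \<alpha> \<mu> q v = (snd q powr \<alpha> - \<mu>) * rel_arc_density v"

definition action ::
    "(real \<times> real \<Rightarrow> real \<times> real \<Rightarrow> real) \<Rightarrow> real \<Rightarrow> real \<Rightarrow> (real \<Rightarrow> real \<times> real) \<Rightarrow> real" where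
  "action L a b \<gamma> = integral {a..b} (\<lambda>t. L (\<gamma> t) (deriv_in {a..b} \<gamma> t))"

definition weight_functional ::
    "real \<Rightarrow> real \<Rightarrow> real \<Rightarrow> real \<Rightarrow> (real \<Rightarrow> real \<times> real) \<Rightarrow> real" where
  "weight_functional \<alpha> \<mu> = action (weight_lagrangian \<alpha> \<mu>)"

text \<open>
  The first variation vanishes for every smooth variation field fixing both endpoints. Both
  coordinates are varied. The requirements \<open>z > 0\<close> and \<open>x' > 0\<close> on the curve are open conditions on
  the compact interval, so the varied curves satisfy them for all sufficiently small
  \<open>\<epsilon>\<close>, and only those matter for the derivative at \<open>0\<close>.
\<close>

definition critical_point ::
    "((real \<Rightarrow> real \<times> real) \<Rightarrow> real) \<Rightarrow> real \<Rightarrow> real \<Rightarrow> (real \<Rightarrow> real \<times> real) \<Rightarrow> bool" where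
  "critical_point F a b \<gamma> \<longleftrightarrow>
     (\<forall>\<eta>. smooth_in {a..b} \<eta> \<longrightarrow> \<eta> a = 0 \<longrightarrow> \<eta> b = 0 \<longrightarrow>
        ((\<lambda>\<epsilon>. F (\<lambda>t. \<gamma> t + \<epsilon> *\<^sub>R \<eta> t)) has_real_derivative 0) (at 0))"

text \<open>
  The Euler-Lagrange equations of \<^term>\<open>action L a b\<close>, one for each coordinate: the time
  derivative of the partial derivative of \<open>L\<close> in the velocity equals its partial derivative in the
  position.
\<close>

definition euler_lagrange ::
    "(real \<times> real \<Rightarrow> real \<times> real \<Rightarrow> real) \<Rightarrow> real \<Rightarrow> real \<Rightarrow> (real \<Rightarrow> real \<times> real) \<Rightarrow> bool" where
  "euler_lagrange L a b \<gamma> \<longleftrightarrow>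
     (let v = deriv_in {a..b} \<gamma> in
      \<forall>t\<in>{a..b}.
        ((\<lambda>s. deriv (\<lambda>p. L (\<gamma> s) (p, snd (v s))) (fst (v s))) has_real_derivative
           deriv (\<lambda>x. L (x, snd (\<gamma> t)) (v t)) (fst (\<gamma> t))) (at t within {a..b}) \<and>
        ((\<lambda>s. deriv (\<lambda>p. L (\<gamma> s) (fst (v s), p)) (snd (v s))) has_real_derivative
           deriv (\<lambda>z. L (fst (\<gamma> t), z) (v t)) (snd (\<gamma> t))) (at t within {a..b}))"

end

theory Submission
  imports Defs
begin

text \<open>
  Along the graph of \<open>z\<close> put \<open>E = \<alpha> z\<^sup>\<alpha>\<^sup>-\<^sup>1 (1 - z'\<^sup>2) / 2 - (z\<^sup>\<alpha> - \<mu>) z''\<close>. Differentiating under the integral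
  and integrating by parts, the first variation in the direction \<open>(\<xi>, \<zeta>)\<close> is the integral of
  \<open>E (\<zeta> - z' \<xi>)\<close>, so reparametrisation gives no condition beyond \<open>E = 0\<close>. Conversely, polynomial
  fields \<open>(0, (t - a) (b - t) q)\<close> suffice to force \<open>E = 0\<close>, because polynomials are uniformly dense
  in the continuous functions; this avoids bump functions.
\<close>

section \<open>Derivatives and smoothness on a compact interval\<close>

text \<open>Since \<open>a < b\<close>, every point of the interval is a limit point of it, so
  derivatives within it are unique, at the endpoints too.\<close>

lemma deriv_in_eqI:
  assumes "a < b" "t \<in> {a..b}" "(f has_vector_derivative f') (at t within {a..b})"
  shows "deriv_in {a..b} f t = f'"
  unfolding deriv_in_def using assms vector_derivative_within_cbox[of a b t f f'] by simp

lemma smooth_in_has_vector_derivative: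
  assumes "smooth_in S f" "t \<in> S"
  shows "((deriv_in S ^^ k) f has_vector_derivative (deriv_in S ^^ Suc k) f t) (at t within S)"
  using assms
  by (simp add: smooth_in_def differentiable_on_def deriv_in_def vector_derivative_works[symmetric])

lemma smooth_in_continuous_on:
  assumes "smooth_in S f"
  shows "continuous_on S ((deriv_in S ^^ k) f)"
  using assms by (simp add: smooth_in_def differentiable_imp_continuous_on)

text \<open>Off the interval \<open>deriv_in\<close> has an unspecified value, so the induction
  shows only that each iterate agrees on \<open>{a..b}\<close> with some polynomial, which is enough
  for differentiability there.\<close>

lemma polynomial_function_smooth_in:
  fixes f :: "real \<Rightarrow> 'a::euclidean_space"
  assumes "a < b" "polynomial_function f"
  shows "smooth_in {a..b} f"
proof -
  have poly: "\<exists>p. polynomial_function p \<and> (\<forall>t\<in>{a..b}. (deriv_in {a..b} ^^ k) f t = p t)" for k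
  proof (induction k)
    case 0
    show ?case using assms(2) by auto
  next
    case (Suc k)
    then obtain p where p: "polynomial_function p" "\<forall>t\<in>{a..b}. (deriv_in {a..b} ^^ k) f t = p t"
      by blast
    obtain p' where p': "polynomial_function p'" "\<And>x. (p has_vector_derivative p' x) (at x)"
      using has_vector_derivative_polynomial_function[OF p(1)] by blast
    have "(deriv_in {a..b} ^^ Suc k) f t = p' t" if "t \<in> {a..b}" for t
    proof -
      have "((deriv_in {a..b} ^^ k) f has_vector_derivative p' t) (at t within {a..b})"
        by (rule has_vector_derivative_transform[OF that _ has_vector_derivative_at_within[OF p'(2)]])
          (use p(2) in auto)
      then show ?thesis using deriv_in_eqI[OF assms(1) that] by simp
    qed
    then show ?case using p'(1) by blast
  qed
  show ?thesis
    unfolding smooth_in_def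
  proof
    fix k
    obtain p where p: "polynomial_function p" "\<forall>t\<in>{a..b}. (deriv_in {a..b} ^^ k) f t = p t"
      using poly by blast
    then show "(deriv_in {a..b} ^^ k) f differentiable_on {a..b}"
      using differentiable_on_polynomial_function[OF p(1), of "{a..b}"]
      by (metis (no_types, lifting) differentiable_on_def differentiable_transform_within zero_less_one)
  qed
qed

text \<open>Iterated derivatives are taken componentwise. As these identities hold on the interval
  only, each differentiation step goes through a transfer within it.\<close>

lemma smooth_in_Pair:
  assumes "a < b" "smooth_in {a..b} f" "smooth_in {a..b} g"
  shows "smooth_in {a..b} (\<lambda>t. (f t, g t))"
proof -
  let ?D = "deriv_in {a..b}"
  have deriv: "((\<lambda>t. ((?D ^^ k) f t, (?D ^^ k) g t)) has_vector_derivative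
      ((?D ^^ Suc k) f t, (?D ^^ Suc k) g t)) (at t within {a..b})" if "t \<in> {a..b}" for k t
    by (intro has_vector_derivative_Pair smooth_in_has_vector_derivative assms that)
  have eq: "\<forall>t\<in>{a..b}. (?D ^^ k) (\<lambda>t. (f t, g t)) t = ((?D ^^ k) f t, (?D ^^ k) g t)" for k
  proof (induction k)
    case (Suc k)
    show ?case
    proof
      fix t assume t: "t \<in> {a..b}"
      have "((?D ^^ k) (\<lambda>t. (f t, g t)) has_vector_derivative
          ((?D ^^ Suc k) f t, (?D ^^ Suc k) g t)) (at t within {a..b})"
        by (rule has_vector_derivative_transform[OF t _ deriv[OF t]]) (use Suc in auto)
      then show "(?D ^^ Suc k) (\<lambda>t. (f t, g t)) t = ((?D ^^ Suc k) f t, (?D ^^ Suc k) g t)"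
        using deriv_in_eqI[OF assms(1) t] by simp
    qed
  qed auto
  have "((?D ^^ k) (\<lambda>t. (f t, g t)) has_vector_derivative
      ((?D ^^ Suc k) f t, (?D ^^ Suc k) g t)) (at t within {a..b})" if "t \<in> {a..b}" for k t
    by (rule has_vector_derivative_transform[OF that _ deriv[OF that]]) (use eq in auto)
  then show ?thesis
    unfolding smooth_in_def differentiable_on_def by (meson differentiableI_vector)
qed

section \<open>The fundamental lemma of the calculus of variations\<close>

text \<open>Let \<open>H\<close> be \<open>G\<close> times the weight
  \<open>(t - a) * (b - t)\<close>. By hypothesis \<open>H\<close> is orthogonal to all polynomials;
  approximating \<open>H\<close> itself uniformly by a polynomial \<open>q\<close>, the integral of
  \<open>H * H\<close> equals that of \<open>H * (H - q)\<close>, which is arbitrarily small. Hence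
  \<open>H\<close> vanishes.\<close>

lemma fundamental_lemma_polynomial:
  fixes G :: "real \<Rightarrow> real"
  assumes "a < b" and G: "continuous_on {a..b} G"
    and orth: "\<And>q. real_polynomial_function q \<Longrightarrow>
      integral {a..b} (\<lambda>t. G t * ((t - a) * (b - t) * q t)) = 0"
    and "t \<in> {a..b}"
  shows "G t = 0"
proof -
  define H where "H = (\<lambda>t. G t * ((t - a) * (b - t)))"
  have H: "continuous_on {a..b} H"
    unfolding H_def by (intro continuous_intros G)
  have "bounded (H ` {a..b})"
    using H compact_continuous_image compact_imp_bounded compact_Icc by blast
  then obtain M where M: "M > 0" "\<And>t. t \<in> {a..b} \<Longrightarrow> \<bar>H t\<bar> \<le> M"
    by (auto simp: bounded_pos)
  have "\<bar>integral {a..b} (\<lambda>t. H t * H t)\<bar> \<le> e" if "e > 0" for e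
  proof -
    \<comment> \<open>This tolerance, multiplied by the bound \<open>M\<close> of \<open>H\<close>
      and by the length \<open>b - a\<close>, gives exactly \<open>e\<close>.\<close>
    have "e / (M * (b - a)) > 0" using that M assms by simp
    then obtain q where q: "real_polynomial_function q"
      "\<And>t. t \<in> {a..b} \<Longrightarrow> \<bar>H t - q t\<bar> < e / (M * (b - a))"
      using Stone_Weierstrass_real_polynomial_function[OF compact_Icc H] by blast
    have cq: "continuous_on {a..b} q"
      using q(1) continuous_on_polymonial_function real_polynomial_function_eq by blast
    have "integral {a..b} (\<lambda>t. H t * q t) = 0"
      using orth[OF q(1)] by (simp add: H_def mult.assoc)
    moreover have "integral {a..b} (\<lambda>t. H t * (H t - q t)) =
        integral {a..b} (\<lambda>t. H t * H t) - integral {a..b} (\<lambda>t. H t * q t)"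
      unfolding right_diff_distrib
      by (intro Henstock_Kurzweil_Integration.integral_diff integrable_continuous_real continuous_intros H cq)
    ultimately have "integral {a..b} (\<lambda>t. H t * H t) = integral {a..b} (\<lambda>t. H t * (H t - q t))"
      by simp
    moreover have "norm (integral {a..b} (\<lambda>t. H t * (H t - q t))) \<le> e / (b - a) * (b - a)"
    proof (rule integral_bound)
      fix t assume t: "t \<in> {a..b}"
      have "\<bar>H t * (H t - q t)\<bar> \<le> M * (e / (M * (b - a)))"
        unfolding abs_mult using M(2)[OF t] q(2)[OF t] M(1) by (intro mult_mono) auto
      then show "norm (H t * (H t - q t)) \<le> e / (b - a)" using M(1) by simp
    next
      show "continuous_on {a..b} (\<lambda>t. H t * (H t - q t))" by (intro continuous_intros H cq)
    qed (use assms in simp)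
    ultimately show ?thesis using assms by simp
  qed
  then have "integral {a..b} (\<lambda>t. H t * H t) = 0"
    using field_le_epsilon[of "\<bar>integral {a..b} (\<lambda>t. H t * H t)\<bar>" 0] by simp
  then have H0: "H t = 0" if "t \<in> {a..b}" for t
    using integral_eq_0_iff[OF continuous_on_mult[OF H H] assms(1)] that by simp
  \<comment> \<open>The weight is nonzero only in the open interval; continuity of \<open>G\<close>
    then covers the endpoints.\<close>
  have "G s = 0" if "s \<in> {a<..<b}" for s
    using H0[of s] that by (auto simp: H_def)
  then show ?thesis
    using continuous_constant_on_closure[of "{a<..<b}" G 0 t] assms by simp
qed

section \<open>Differentiation of the functional under the integral sign\<close>

text \<open>The differential of \<open>weight_lagrangian\<close> at position \<open>q\<close> and
  velocity \<open>v\<close>, applied to the displacements \<open>h\<close> of \<open>q\<close> and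
  \<open>k\<close> of \<open>v\<close>.\<close>

definition variation_density ::
    "real \<Rightarrow> real \<Rightarrow> real \<times> real \<Rightarrow> real \<times> real \<Rightarrow> real \<times> real \<Rightarrow> real \<times> real \<Rightarrow> real" where
  "variation_density \<alpha> \<mu> q v h k =
     \<alpha> * snd q powr (\<alpha> - 1) * snd h * rel_arc_density v +
     (snd q powr \<alpha> - \<mu>) * (fst k / 2 + snd v * snd k / fst v - (snd v)\<^sup>2 * fst k / (2 * (fst v)\<^sup>2))"

text \<open>Stated at every admissible \<epsilon>, not only at 0, because the Leibniz rule needs the
  derivative on a whole neighbourhood of 0.\<close>

lemma weight_lagrangian_has_derivative_along_line:
  assumes "snd (q + \<epsilon> *\<^sub>R h) > 0" "fst (v + \<epsilon> *\<^sub>R k) > 0"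
  shows "((\<lambda>\<epsilon>. weight_lagrangian \<alpha> \<mu> (q + \<epsilon> *\<^sub>R h) (v + \<epsilon> *\<^sub>R k)) has_real_derivative
    variation_density \<alpha> \<mu> (q + \<epsilon> *\<^sub>R h) (v + \<epsilon> *\<^sub>R k) h k) (at \<epsilon> within U)"
proof -
  define V1 V2 where "V1 = (\<lambda>\<epsilon>. fst v + \<epsilon> * fst k)" and "V2 = (\<lambda>\<epsilon>. snd v + \<epsilon> * snd k)"
  have V: "(V1 has_real_derivative fst k) (at \<epsilon> within U)" "(V2 has_real_derivative snd k) (at \<epsilon> within U)"
    unfolding V1_def V2_def by (auto intro!: derivative_eq_intros)
  have ne: "V1 \<epsilon> \<noteq> 0" using assms(2) by (simp add: V1_def)
  have R: "((\<lambda>\<epsilon>. V1 \<epsilon> / 2 + (V2 \<epsilon>)\<^sup>2 / (2 * V1 \<epsilon>)) has_real_derivative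
      fst k / 2 + V2 \<epsilon> * snd k / V1 \<epsilon> - (V2 \<epsilon>)\<^sup>2 * fst k / (2 * (V1 \<epsilon>)\<^sup>2)) (at \<epsilon> within U)"
    by (rule derivative_eq_intros V refl | simp add: ne)+
      (use ne in \<open>simp add: field_simps power2_eq_square\<close>)
  have Q: "((\<lambda>\<epsilon>. (snd q + \<epsilon> * snd h) powr \<alpha> - \<mu>) has_real_derivative
      \<alpha> * (snd q + \<epsilon> * snd h) powr (\<alpha> - 1) * snd h) (at \<epsilon> within U)"
    using assms(1) by (auto intro!: derivative_eq_intros)
  show ?thesis
    using DERIV_mult[OF Q R]
    by (simp add: weight_lagrangian_def variation_density_def rel_arc_density_def V1_def V2_def algebra_simps)
qed

text \<open>The partial derivatives that enter \<open>euler_lagrange\<close>, at horizontal speed 1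
  as on a graph with slope \<open>c\<close>. The factor \<open>1 / 2 - c\<^sup>2 / 2\<close> is the
  isotropic component of the parabolic normal.\<close>

lemma weight_lagrangian_partial_derivatives:
  shows "((\<lambda>p. weight_lagrangian \<alpha> \<mu> q (p, c)) has_real_derivative
      (snd q powr \<alpha> - \<mu>) * (1 / 2 - c\<^sup>2 / 2)) (at 1)"
    and "((\<lambda>p. weight_lagrangian \<alpha> \<mu> q (1, p)) has_real_derivative (snd q powr \<alpha> - \<mu>) * c) (at c)"
    and "((\<lambda>x. weight_lagrangian \<alpha> \<mu> (x, y) v) has_real_derivative 0) (at x)"
    and "y > 0 \<Longrightarrow> ((\<lambda>y. weight_lagrangian \<alpha> \<mu> (x, y) (1, c)) has_real_derivative
      \<alpha> * y powr (\<alpha> - 1) * (1 / 2 + c\<^sup>2 / 2)) (at y)"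
  unfolding weight_lagrangian_def rel_arc_density_def fst_conv snd_conv
  by (auto intro!: derivative_eq_intros simp: power2_eq_square)

text \<open>By compactness \<open>f\<close> has a positive minimum \<open>f t0\<close> and
  \<open>g\<close> is bounded by some \<open>M\<close>; the quotient \<open>f t0 / M\<close> serves
  as \<delta>.\<close>

lemma continuous_positive_perturbation:
  fixes f g :: "real \<Rightarrow> real"
  assumes "continuous_on {a..b} f" "continuous_on {a..b} g" "\<And>t. t \<in> {a..b} \<Longrightarrow> f t > 0"
  shows "\<exists>\<delta>>0. \<forall>\<epsilon>\<in>{-\<delta><..<\<delta>}. \<forall>t\<in>{a..b}. f t + \<epsilon> * g t > 0"
proof (cases "{a..b} = {}")
  case False
  obtain t0 where t0: "t0 \<in> {a..b}" "\<And>t. t \<in> {a..b} \<Longrightarrow> f t0 \<le> f t"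
    using continuous_attains_inf[OF compact_Icc False assms(1)] by blast
  have "bounded (g ` {a..b})"
    using assms(2) compact_continuous_image compact_imp_bounded compact_Icc by blast
  then obtain M where M: "M > 0" "\<And>t. t \<in> {a..b} \<Longrightarrow> \<bar>g t\<bar> \<le> M"
    by (auto simp: bounded_pos)
  have "f t + \<epsilon> * g t > 0" if "\<epsilon> \<in> {-(f t0 / M)<..<f t0 / M}" "t \<in> {a..b}" for \<epsilon> t
  proof -
    have "\<bar>\<epsilon> * g t\<bar> \<le> \<bar>\<epsilon>\<bar> * M" unfolding abs_mult using M(2)[OF that(2)] by (intro mult_left_mono) auto
    also have "\<dots> < f t0" using that(1) M(1) by (auto simp: field_simps abs_if)
    also have "\<dots> \<le> f t" using t0 that by blast
    finally show ?thesis by linarith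
  qed
  then show ?thesis using t0(1) assms(3) M(1) by (intro exI[of _ "f t0 / M"]) auto
qed (auto intro: exI[of _ 1])

text \<open>For small \<epsilon> the varied curve keeps positive height and positive horizontal
  speed, so the integrand is differentiable in \<epsilon> with jointly continuous derivative, and
  the Leibniz rule applies.\<close>

lemma weight_functional_first_variation:
  assumes "a < b" and \<gamma>: "smooth_in {a..b} \<gamma>" and \<eta>: "smooth_in {a..b} \<eta>"
    and pos: "\<And>t. t \<in> {a..b} \<Longrightarrow> snd (\<gamma> t) > 0" "\<And>t. t \<in> {a..b} \<Longrightarrow> fst (deriv_in {a..b} \<gamma> t) > 0"
  shows "((\<lambda>\<epsilon>. weight_functional \<alpha> \<mu> a b (\<lambda>t. \<gamma> t + \<epsilon> *\<^sub>R \<eta> t)) has_real_derivative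
    integral {a..b} (\<lambda>t. variation_density \<alpha> \<mu> (\<gamma> t) (deriv_in {a..b} \<gamma> t) (\<eta> t) (deriv_in {a..b} \<eta> t))) (at 0)"
proof -
  define v where "v = deriv_in {a..b} \<gamma>"
  define k where "k = deriv_in {a..b} \<eta>"
  have cont: "continuous_on {a..b} \<gamma>" "continuous_on {a..b} v"
    "continuous_on {a..b} \<eta>" "continuous_on {a..b} k"
    using smooth_in_continuous_on[OF \<gamma>, of 0] smooth_in_continuous_on[OF \<gamma>, of 1]
      smooth_in_continuous_on[OF \<eta>, of 0] smooth_in_continuous_on[OF \<eta>, of 1]
    by (simp_all add: v_def k_def)
  have "\<exists>d>0. \<forall>\<epsilon>\<in>{-d<..<d}. \<forall>t\<in>{a..b}. snd (\<gamma> t) + \<epsilon> * snd (\<eta> t) > 0"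
    by (intro continuous_positive_perturbation continuous_intros cont pos(1))
  then obtain d where d: "d > 0" "\<And>\<epsilon> t. \<epsilon> \<in> {-d<..<d} \<Longrightarrow> t \<in> {a..b} \<Longrightarrow> snd (\<gamma> t) + \<epsilon> * snd (\<eta> t) > 0"
    by blast
  have "\<exists>e>0. \<forall>\<epsilon>\<in>{-e<..<e}. \<forall>t\<in>{a..b}. fst (v t) + \<epsilon> * fst (k t) > 0"
    using pos(2) by (intro continuous_positive_perturbation continuous_intros cont) (simp add: v_def)
  then obtain e where e: "e > 0" "\<And>\<epsilon> t. \<epsilon> \<in> {-e<..<e} \<Longrightarrow> t \<in> {a..b} \<Longrightarrow> fst (v t) + \<epsilon> * fst (k t) > 0"
    by blast
  \<comment> \<open>An interval around 0 on which both positivity conditions persist: convex, as the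
    Leibniz rule asks, and open, so that the derivative within \<open>U\<close> at 0 is the full
    derivative.\<close>
  define U where "U = {- min d e<..<min d e}"
  have U: "open U" "convex U" "0 \<in> U" using d(1) e(1) by (auto simp: U_def)
  have posU: "snd (\<gamma> t) + \<epsilon> * snd (\<eta> t) > 0" "fst (v t) + \<epsilon> * fst (k t) > 0"
    if "\<epsilon> \<in> U" "t \<in> {a..b}" for \<epsilon> t
    using d(2)[of \<epsilon> t] e(2)[of \<epsilon> t] that by (auto simp: U_def)
  \<comment> \<open>The form in which the continuity rules for \<open>powr\<close> and division
    raise their side conditions.\<close>
  have neU: "snd (\<gamma> t + \<epsilon> *\<^sub>R \<eta> t) \<noteq> 0" "fst (v t + \<epsilon> *\<^sub>R k t) \<noteq> 0"
    if "\<epsilon> \<in> U" "t \<in> {a..b}" for \<epsilon> t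
    using posU[OF that] by simp_all
  define f where "f = (\<lambda>\<epsilon> t. weight_lagrangian \<alpha> \<mu> (\<gamma> t + \<epsilon> *\<^sub>R \<eta> t) (v t + \<epsilon> *\<^sub>R k t))"
  define fd where "fd = (\<lambda>\<epsilon> t. variation_density \<alpha> \<mu> (\<gamma> t + \<epsilon> *\<^sub>R \<eta> t) (v t + \<epsilon> *\<^sub>R k t) (\<eta> t) (k t))"
  have deriv_line: "deriv_in {a..b} (\<lambda>t. \<gamma> t + \<epsilon> *\<^sub>R \<eta> t) t = v t + \<epsilon> *\<^sub>R k t" if "t \<in> {a..b}" for \<epsilon> t
    using smooth_in_has_vector_derivative[OF \<gamma> that, of 0]
      smooth_in_has_vector_derivative[OF \<eta> that, of 0]
    by (intro deriv_in_eqI[OF \<open>a < b\<close> that])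
      (auto intro!: derivative_eq_intros simp: v_def k_def)
  have F: "weight_functional \<alpha> \<mu> a b (\<lambda>t. \<gamma> t + \<epsilon> *\<^sub>R \<eta> t) = integral (cbox a b) (f \<epsilon>)" for \<epsilon>
    unfolding weight_functional_def action_def f_def
    by (auto intro!: Henstock_Kurzweil_Integration.integral_cong simp: deriv_line)
  have "((\<lambda>\<epsilon>. integral (cbox a b) (f \<epsilon>)) has_field_derivative integral (cbox a b) (fd 0)) (at 0 within U)"
  proof (rule leibniz_rule_field_derivative)
    fix \<epsilon> t :: real assume "\<epsilon> \<in> U" "t \<in> cbox a b"
    then show "((\<lambda>\<epsilon>. f \<epsilon> t) has_field_derivative fd \<epsilon> t) (at \<epsilon> within U)"
      unfolding f_def fd_def
      by (intro weight_lagrangian_has_derivative_along_line) (use posU in auto)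
  next
    fix \<epsilon> assume "\<epsilon> \<in> U"
    then show "f \<epsilon> integrable_on cbox a b"
      unfolding f_def weight_lagrangian_def rel_arc_density_def box_real
      by (intro integrable_continuous_real continuous_intros cont ballI)
        (simp_all only: neU mult_eq_0_iff power_eq_0_iff zero_neq_numeral simp_thms)
  next
    \<comment> \<open>Functions of \<open>t\<close> alone, viewed as functions of the pair
      (\<epsilon>, t), for the joint continuity of \<open>fd\<close>.\<close>
    have snd_cont: "continuous_on (U \<times> {a..b}) (\<lambda>x. g (snd x))"
      if "continuous_on {a..b} g" for g :: "real \<Rightarrow> real \<times> real"
      by (rule continuous_on_compose2[OF that continuous_on_snd[OF continuous_on_id]]) auto
    show "continuous_on (U \<times> cbox a b) (\<lambda>(\<epsilon>, t). fd \<epsilon> t)"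
      unfolding fd_def variation_density_def rel_arc_density_def box_real case_prod_beta
      by (intro continuous_intros cont[THEN snd_cont] ballI)
        (simp_all only: mem_Times_iff neU mult_eq_0_iff power_eq_0_iff zero_neq_numeral simp_thms)
  qed (use U in auto)
  then show ?thesis
    unfolding at_within_open[OF U(3,1)] F[symmetric] by (simp only: fd_def v_def k_def scaleR_zero_left add_0_right box_real)
qed

section \<open>Momenta and the first variation along a graph\<close>

text \<open>
  For \<open>z1\<close> and \<open>z2\<close> the first two derivatives of \<open>z\<close>, this is the Euler-Lagrange expression of the
  \<open>z\<close>-coordinate; the one of the \<open>x\<close>-coordinate turns out to be its product with \<open>- z1\<close>.
\<close>

definition el_defect ::
    "real \<Rightarrow> real \<Rightarrow> (real \<Rightarrow> real) \<Rightarrow> (real \<Rightarrow> real) \<Rightarrow> (real \<Rightarrow> real) \<Rightarrow> real \<Rightarrow> real" where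
  "el_defect \<alpha> \<mu> z z1 z2 t =
     \<alpha> * z t powr (\<alpha> - 1) * (1 / 2 - (z1 t)\<^sup>2 / 2) - (z t powr \<alpha> - \<mu>) * z2 t"

context
  fixes \<alpha> \<mu> a b :: real and z z1 z2 :: "real \<Rightarrow> real" and \<gamma> :: "real \<Rightarrow> real \<times> real"
  assumes ab: "a < b" and z: "smooth_in {a..b} z"
    and zpos: "\<And>t. t \<in> {a..b} \<Longrightarrow> z t > 0"
    and z1_def: "z1 = deriv_in {a..b} z" and z2_def: "z2 = deriv_in {a..b} z1"
    and \<gamma>_def: "\<gamma> = (\<lambda>t. (t, z t))"
begin

lemma graph_height_has_derivative:
  assumes "t \<in> {a..b}"
  shows "(z has_real_derivative z1 t) (at t within {a..b})"
    "(z1 has_real_derivative z2 t) (at t within {a..b})"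
  using smooth_in_has_vector_derivative[OF z assms, of 0]
    smooth_in_has_vector_derivative[OF z assms, of 1]
  by (simp_all add: z1_def z2_def has_real_derivative_iff_has_vector_derivative)

lemma height_powr_has_derivative:
  assumes "t \<in> {a..b}"
  shows "((\<lambda>t. z t powr \<alpha>) has_real_derivative \<alpha> * z t powr (\<alpha> - 1) * z1 t) (at t within {a..b})"
  using zpos[OF assms] graph_height_has_derivative(1)[OF assms]
  by (auto intro!: derivative_eq_intros)

lemma deriv_in_graph:
  assumes "t \<in> {a..b}"
  shows "deriv_in {a..b} \<gamma> t = (1, z1 t)" "deriv_in {a..b} (deriv_in {a..b} \<gamma>) t = (0, z2 t)"
proof -
  \<comment> \<open>Needed at all points of the interval, since the second derivative differentiates
    this identity.\<close>
  have 1: "deriv_in {a..b} \<gamma> t = (1, z1 t)" if "t \<in> {a..b}" for t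
    unfolding \<gamma>_def using graph_height_has_derivative(1)[OF that]
    by (intro deriv_in_eqI[OF ab that] has_vector_derivative_Pair)
      (auto simp: has_real_derivative_iff_has_vector_derivative intro!: derivative_eq_intros)
  have "((\<lambda>t. (1, z1 t)) has_vector_derivative (0, z2 t)) (at t within {a..b})"
    using graph_height_has_derivative(2)[OF assms]
    by (intro has_vector_derivative_Pair)
      (auto simp: has_real_derivative_iff_has_vector_derivative)
  then have "(deriv_in {a..b} \<gamma> has_vector_derivative (0, z2 t)) (at t within {a..b})"
    by (rule has_vector_derivative_transform[OF assms, rotated]) (simp add: 1)
  then show "deriv_in {a..b} (deriv_in {a..b} \<gamma>) t = (0, z2 t)"
    by (rule deriv_in_eqI[OF ab assms])
  show "deriv_in {a..b} \<gamma> t = (1, z1 t)" by (rule 1[OF assms])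
qed

abbreviation defect :: "real \<Rightarrow> real" where
  "defect \<equiv> el_defect \<alpha> \<mu> z z1 z2"

text \<open>The differentiated functions are the momenta, the partial derivatives of the Lagrangian
  in the two velocity components. That the first rate is a multiple of \<open>defect\<close> is the
  Noether identity of reparametrisation invariance: the Lagrangian is homogeneous of degree one in
  the velocity.\<close>

lemma momenta_have_derivative:
  assumes "t \<in> {a..b}"
  shows "((\<lambda>s. (z s powr \<alpha> - \<mu>) * (1 / 2 - (z1 s)\<^sup>2 / 2)) has_real_derivative
      z1 t * defect t) (at t within {a..b})"
    and "((\<lambda>s. (z s powr \<alpha> - \<mu>) * z1 s) has_real_derivative
      \<alpha> * z t powr (\<alpha> - 1) * (1 / 2 + (z1 t)\<^sup>2 / 2) - defect t) (at t within {a..b})"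
  unfolding el_defect_def
  by (rule derivative_eq_intros height_powr_has_derivative graph_height_has_derivative assms refl
      | simp add: algebra_simps power2_eq_square add_divide_distrib)+

lemma continuous_on_defect: "continuous_on {a..b} defect"
proof -
  have "continuous_on {a..b} z" "continuous_on {a..b} z1" "continuous_on {a..b} z2"
    using smooth_in_continuous_on[OF z, of 0] smooth_in_continuous_on[OF z, of 1]
      smooth_in_continuous_on[OF z, of 2]
    by (simp_all add: z1_def z2_def numeral_2_eq_2)
  then show ?thesis
    unfolding el_defect_def using zpos by (intro continuous_intros) (auto simp: less_imp_neq[THEN not_sym])
qed

text \<open>Integration by parts: the boundary term is the pairing of the momenta with \<open>\<eta>\<close>.\<close>

lemma integral_variation_density:
  assumes \<eta>: "smooth_in {a..b} \<eta>" "\<eta> a = 0" "\<eta> b = 0"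
  shows "integral {a..b} (\<lambda>t. variation_density \<alpha> \<mu> (\<gamma> t) (deriv_in {a..b} \<gamma> t) (\<eta> t) (deriv_in {a..b} \<eta> t)) =
    integral {a..b} (\<lambda>t. defect t * (snd (\<eta> t) - z1 t * fst (\<eta> t)))"
proof -
  define k where "k = deriv_in {a..b} \<eta>"
  define V where "V = (\<lambda>t. variation_density \<alpha> \<mu> (\<gamma> t) (1, z1 t) (\<eta> t) (k t))"
  define W where "W = (\<lambda>t. defect t * (snd (\<eta> t) - z1 t * fst (\<eta> t)))"
  define P where "P = (\<lambda>t. (z t powr \<alpha> - \<mu>) * (1 / 2 - (z1 t)\<^sup>2 / 2) * fst (\<eta> t) +
    (z t powr \<alpha> - \<mu>) * z1 t * snd (\<eta> t))"
  \<comment> \<open>The terms with \<open>k\<close> are those of \<open>V\<close>; the momentum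
    rates supply the position term of \<open>V\<close> and, with opposite sign,
    \<open>W\<close>.\<close>
  have P': "(P has_real_derivative V t - W t) (at t within {a..b})" if t: "t \<in> {a..b}" for t
  proof -
    have "(\<eta> has_vector_derivative k t) (at t within {a..b})"
      using smooth_in_has_vector_derivative[OF \<eta>(1) t, of 0] by (simp add: k_def)
    then have \<eta>': "((\<lambda>t. fst (\<eta> t)) has_real_derivative fst (k t)) (at t within {a..b})"
      "((\<lambda>t. snd (\<eta> t)) has_real_derivative snd (k t)) (at t within {a..b})"
      unfolding has_real_derivative_iff_has_vector_derivative
      by (simp_all add: bounded_linear.has_vector_derivative[OF bounded_linear_fst]
          bounded_linear.has_vector_derivative[OF bounded_linear_snd])
    show ?thesis
      unfolding P_def
      by (rule DERIV_cong[OF DERIV_add[OF DERIV_mult[OF momenta_have_derivative(1)[OF t] \<eta>'(1)]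
              DERIV_mult[OF momenta_have_derivative(2)[OF t] \<eta>'(2)]]])
        (simp add: V_def W_def variation_density_def rel_arc_density_def \<gamma>_def algebra_simps add_divide_distrib diff_divide_distrib)
  qed
  have "((\<lambda>t. V t - W t) has_integral P b - P a) {a..b}"
    using P' ab by (intro fundamental_theorem_of_calculus)
      (auto simp: has_real_derivative_iff_has_vector_derivative)
  then have VW: "((\<lambda>t. V t - W t) has_integral 0) {a..b}"
    using \<eta> by (simp add: P_def)
  \<comment> \<open>Integrability of \<open>W\<close> passes to \<open>V\<close>, the sum of
    \<open>W\<close> and the integrable \<open>V - W\<close>.\<close>
  have "continuous_on {a..b} W"
  proof -
    have "continuous_on {a..b} z1" "continuous_on {a..b} \<eta>"
      using smooth_in_continuous_on[OF z, of 1] smooth_in_continuous_on[OF \<eta>(1), of 0]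
      by (simp_all add: z1_def)
    then show ?thesis unfolding W_def by (intro continuous_intros continuous_on_defect)
  qed
  then have "(W has_integral integral {a..b} W) {a..b}"
    by (simp add: integrable_continuous_real integrable_integral)
  from has_integral_add[OF VW this] have "integral {a..b} V = integral {a..b} W"
    by (simp add: integral_unique)
  moreover have "integral {a..b} V = integral {a..b}
      (\<lambda>t. variation_density \<alpha> \<mu> (\<gamma> t) (deriv_in {a..b} \<gamma> t) (\<eta> t) (deriv_in {a..b} \<eta> t))"
    by (rule Henstock_Kurzweil_Integration.integral_cong) (simp add: V_def k_def deriv_in_graph)
  ultimately show ?thesis by (simp add: W_def)
qed

text \<open>Only the vertical offset \<open>snd (\<eta> t) - z1 t * fst (\<eta> t)\<close> from the
  tangent direction \<open>(1, z1 t)\<close> counts; tangential fields contribute nothing.\<close>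

lemma first_variation_graph:
  assumes \<eta>: "smooth_in {a..b} \<eta>" "\<eta> a = 0" "\<eta> b = 0"
  shows "((\<lambda>\<epsilon>. weight_functional \<alpha> \<mu> a b (\<lambda>t. \<gamma> t + \<epsilon> *\<^sub>R \<eta> t)) has_real_derivative
    integral {a..b} (\<lambda>t. defect t * (snd (\<eta> t) - z1 t * fst (\<eta> t)))) (at 0)"
proof -
  have \<gamma>: "smooth_in {a..b} \<gamma>"
    unfolding \<gamma>_def by (intro smooth_in_Pair polynomial_function_smooth_in ab z polynomial_function_id)
  have pos: "snd (\<gamma> t) > 0" "fst (deriv_in {a..b} \<gamma> t) > 0" if "t \<in> {a..b}" for t
    using zpos[OF that] deriv_in_graph(1)[OF that] by (simp_all add: \<gamma>_def)
  show ?thesis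
    by (rule DERIV_cong[OF weight_functional_first_variation[OF ab \<gamma> \<eta>(1) pos] integral_variation_density[OF assms]])
qed

section \<open>Each condition reduced to the vanishing of the defect\<close>

lemma critical_point_iff_defect:
  "critical_point (weight_functional \<alpha> \<mu> a b) a b \<gamma> \<longleftrightarrow> (\<forall>t\<in>{a..b}. defect t = 0)"
proof
  assume crit: "critical_point (weight_functional \<alpha> \<mu> a b) a b \<gamma>"
  show "\<forall>t\<in>{a..b}. defect t = 0"
  proof (intro ballI fundamental_lemma_polynomial[OF ab continuous_on_defect])
    fix q :: "real \<Rightarrow> real" assume q: "real_polynomial_function q"
    \<comment> \<open>A vertical field, so the offset is its second component; the quadratic factor
      makes it vanish at both endpoints.\<close>
    define \<eta> :: "real \<Rightarrow> real \<times> real" where "\<eta> = (\<lambda>t. (0, (t - a) * (b - t) * q t))"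
    have "polynomial_function (\<lambda>t. (t - a) * (b - t) * q t)"
      unfolding real_polynomial_function_eq[symmetric]
      by (intro real_polynomial_function.intros(2-4) real_polynomial_function_diff q
          real_polynomial_function.intros(1)[OF bounded_linear_ident])
    then have \<eta>: "smooth_in {a..b} \<eta>" "\<eta> a = 0" "\<eta> b = 0"
      unfolding \<eta>_def
      by (simp_all add: smooth_in_Pair polynomial_function_smooth_in ab zero_prod_def)
    show "integral {a..b} (\<lambda>t. defect t * ((t - a) * (b - t) * q t)) = 0"
      using DERIV_unique[OF first_variation_graph[OF \<eta>] crit[unfolded critical_point_def, rule_format, OF \<eta>]]
      by (simp add: \<eta>_def)
  qed
next
  assume E: "\<forall>t\<in>{a..b}. defect t = 0"
  show "critical_point (weight_functional \<alpha> \<mu> a b) a b \<gamma>"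
    unfolding critical_point_def
  proof (intro allI impI)
    fix \<eta> :: "real \<Rightarrow> real \<times> real"
    assume \<eta>: "smooth_in {a..b} \<eta>" "\<eta> a = 0" "\<eta> b = 0"
    have "integral {a..b} (\<lambda>t. defect t * (snd (\<eta> t) - z1 t * fst (\<eta> t))) = integral {a..b} (\<lambda>t. 0)"
      by (rule Henstock_Kurzweil_Integration.integral_cong) (simp add: E)
    then show "((\<lambda>\<epsilon>. weight_functional \<alpha> \<mu> a b (\<lambda>t. \<gamma> t + \<epsilon> *\<^sub>R \<eta> t)) has_real_derivative 0) (at 0)"
      using first_variation_graph[OF \<eta>] by simp
  qed
qed

text \<open>The \<open>z\<close>-equation compares the rate \<open>C t - defect t\<close> with
  \<open>C t\<close> and so forces \<open>defect t = 0\<close>; the \<open>x\<close>-equation,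
  \<open>z1 t * defect t = 0\<close>, then follows.\<close>

lemma euler_lagrange_iff_defect:
  "euler_lagrange (weight_lagrangian \<alpha> \<mu>) a b \<gamma> \<longleftrightarrow> (\<forall>t\<in>{a..b}. defect t = 0)"
proof -
  define A where "A = (\<lambda>s. (z s powr \<alpha> - \<mu>) * (1 / 2 - (z1 s)\<^sup>2 / 2))"
  define B where "B = (\<lambda>s. (z s powr \<alpha> - \<mu>) * z1 s)"
  define C where "C = (\<lambda>t. \<alpha> * z t powr (\<alpha> - 1) * (1 / 2 + (z1 t)\<^sup>2 / 2))"
  have A: "deriv (\<lambda>p. weight_lagrangian \<alpha> \<mu> (\<gamma> s) (p, snd (deriv_in {a..b} \<gamma> s))) (fst (deriv_in {a..b} \<gamma> s)) = A s"
    and B: "deriv (\<lambda>p. weight_lagrangian \<alpha> \<mu> (\<gamma> s) (fst (deriv_in {a..b} \<gamma> s), p)) (snd (deriv_in {a..b} \<gamma> s)) = B s"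
    and C: "deriv (\<lambda>x. weight_lagrangian \<alpha> \<mu> (fst (\<gamma> s), x) (deriv_in {a..b} \<gamma> s)) (snd (\<gamma> s)) = C s"
    and D: "deriv (\<lambda>x. weight_lagrangian \<alpha> \<mu> (x, snd (\<gamma> s)) (deriv_in {a..b} \<gamma> s)) (fst (\<gamma> s)) = 0"
    if s: "s \<in> {a..b}" for s
    unfolding A_def B_def C_def
    using weight_lagrangian_partial_derivatives[THEN DERIV_imp_deriv] zpos[OF s]
    by (simp_all add: deriv_in_graph(1)[OF s], simp_all add: \<gamma>_def)
  \<comment> \<open>The momenta are identified with \<open>A\<close> and \<open>B\<close> on the
    interval only, which suffices for derivatives within it.\<close>
  have transfer: "(f has_real_derivative d) (at t within {a..b}) \<longleftrightarrow> (g has_real_derivative e) (at t within {a..b})"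
    if "\<And>s. s \<in> {a..b} \<Longrightarrow> f s = g s" "d = e" "t \<in> {a..b}" for f g d e t
    using that has_field_derivative_transform_within[OF _ zero_less_one] by metis
  have "euler_lagrange (weight_lagrangian \<alpha> \<mu>) a b \<gamma> \<longleftrightarrow>
      (\<forall>t\<in>{a..b}. (A has_real_derivative 0) (at t within {a..b}) \<and> (B has_real_derivative C t) (at t within {a..b}))"
    unfolding euler_lagrange_def Let_def
    by (intro ball_cong refl arg_cong2[where f = "(\<and>)"] transfer A B C D)
  also have "\<dots> \<longleftrightarrow> (\<forall>t\<in>{a..b}. defect t = 0)"
  proof (rule ball_cong[OF refl])
    fix t assume t: "t \<in> {a..b}"
    have AB: "(A has_real_derivative z1 t * defect t) (at t within {a..b})"
      "(B has_real_derivative C t - defect t) (at t within {a..b})"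
      using momenta_have_derivative[OF t] by (simp_all add: A_def B_def C_def)
    have uniq: "d = C t - defect t" if "(B has_real_derivative d) (at t within {a..b})" for d
      using deriv_in_eqI[OF ab t that[unfolded has_real_derivative_iff_has_vector_derivative]]
        deriv_in_eqI[OF ab t AB(2)[unfolded has_real_derivative_iff_has_vector_derivative]] by simp
    show "((A has_real_derivative 0) (at t within {a..b}) \<and> (B has_real_derivative C t) (at t within {a..b})) \<longleftrightarrow>
        defect t = 0"
    proof
      assume "defect t = 0"
      then show "(A has_real_derivative 0) (at t within {a..b}) \<and> (B has_real_derivative C t) (at t within {a..b})"
        using AB by simp
    qed (use uniq[of "C t"] in simp)
  qed
  finally show ?thesis .
qed

text \<open>On a graph the curvature is \<open>z2\<close> and the isotropic component of the normal
  is \<open>1 / 2 - (z1 t)\<^sup>2 / 2\<close>, so this is the equation \<open>defect t = 0\<close>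
  divided by \<open>z t powr \<alpha> - \<mu>\<close>. At a zero of that factor division would
  return 0 and the right-hand side would be 0.\<close>

lemma curvature_equation_iff_defect:
  assumes "t \<in> {a..b}" "secondary_metric (\<gamma> t) Z_dir powr \<alpha> - \<mu> \<noteq> 0"
  shows "isotropic_curvature {a..b} \<gamma> t =
      \<alpha> * secondary_metric (\<gamma> t) Z_dir powr (\<alpha> - 1) *
        (secondary_metric (parabolic_normal {a..b} \<gamma> t) Z_dir /
          (secondary_metric (\<gamma> t) Z_dir powr \<alpha> - \<mu>)) \<longleftrightarrow> defect t = 0"
proof -
  have "z t powr \<alpha> - \<mu> \<noteq> 0"
    using assms(2) by (simp add: secondary_metric_def Z_dir_def \<gamma>_def)
  moreover have "secondary_metric (\<gamma> t) Z_dir = z t"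
    by (simp add: secondary_metric_def Z_dir_def \<gamma>_def)
  ultimately show ?thesis
    by (auto simp: isotropic_curvature_def parabolic_normal_def deriv_in_graph[OF assms(1)]
        secondary_metric_def Z_dir_def el_defect_def nonzero_eq_divide_eq mult.commute)
qed

end

theorem theorem4:
  fixes \<alpha> \<mu> a b :: real and z :: "real \<Rightarrow> real" and \<gamma> :: "real \<Rightarrow> real \<times> real"
  assumes "a < b"
    and "smooth_in {a..b} z"
    and "\<And>t. t \<in> {a..b} \<Longrightarrow> z t > 0"
    and "\<gamma> = (\<lambda>t. (t, z t))"
  defines "critical \<equiv> critical_point (weight_functional \<alpha> \<mu> a b) a b \<gamma>"
    and "EL \<equiv> euler_lagrange (weight_lagrangian \<alpha> \<mu>) a b \<gamma>"
    and "ODE \<equiv> \<forall>t\<in>{a..b}.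
      (z t powr \<alpha> - \<mu>) * deriv_in {a..b} (deriv_in {a..b} z) t =
        \<alpha> * z t powr (\<alpha> - 1) * (1 / 2 - (deriv_in {a..b} z t)\<^sup>2 / 2)"
    and "curv \<equiv> \<forall>t\<in>{a..b}.
      isotropic_curvature {a..b} \<gamma> t =
        \<alpha> * secondary_metric (\<gamma> t) Z_dir powr (\<alpha> - 1) *
          (secondary_metric (parabolic_normal {a..b} \<gamma> t) Z_dir /
            (secondary_metric (\<gamma> t) Z_dir powr \<alpha> - \<mu>))"
  shows "(critical \<longleftrightarrow> EL) \<and> (critical \<longleftrightarrow> ODE) \<and>
    ((\<forall>t\<in>{a..b}. secondary_metric (\<gamma> t) Z_dir powr \<alpha> - \<mu> \<noteq> 0) \<longrightarrow> (critical \<longleftrightarrow> curv))"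
proof -
  let ?E = "el_defect \<alpha> \<mu> z (deriv_in {a..b} z) (deriv_in {a..b} (deriv_in {a..b} z))"
  \<comment> \<open>The two reflexivities instantiate \<open>z1\<close> and \<open>z2\<close> with
    the first and second derivatives of \<open>z\<close>.\<close>
  note graph = assms(1-3) refl refl assms(4)
  have "critical \<longleftrightarrow> (\<forall>t\<in>{a..b}. ?E t = 0)"
    unfolding critical_def by (rule critical_point_iff_defect[OF graph])
  moreover have "EL \<longleftrightarrow> (\<forall>t\<in>{a..b}. ?E t = 0)"
    unfolding EL_def by (rule euler_lagrange_iff_defect[OF graph])
  moreover have "ODE \<longleftrightarrow> (\<forall>t\<in>{a..b}. ?E t = 0)"
    unfolding ODE_def el_defect_def right_minus_eq by (intro ball_cong refl eq_commute)
  moreover have "(\<forall>t\<in>{a..b}. secondary_metric (\<gamma> t) Z_dir powr \<alpha> - \<mu> \<noteq> 0) \<longrightarrow>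
      (curv \<longleftrightarrow> (\<forall>t\<in>{a..b}. ?E t = 0))"
    unfolding curv_def
    by (intro impI ball_cong refl curvature_equation_iff_defect[OF graph]) blast+
  ultimately show ?thesis by blast
qed

end
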